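(* Let $H:\mathbb N\to\mathbb N$ be defined by $H(0)=0$ and $H(i)=i-H(H(H(i-1)))$ for $i\ge1$, and let $S=S(0)S(1)S(2)\cdots$ be the infinite word where $S(i)$ is the number of $k\ge0$ with $H(k)=i$ (so $S=12112212112\cdots$, with values in $\{1,2\}$). Then the critical exponent of $S$ is $(\alpha^2+\alpha+5)/3\approx2.8711567558605$, where $\alpha$ is the real root of $X^3=X^2+1$.
   Context: A finite word $w=w[0..n]$ has period $p$ if $w[0..n-p]=w[p..n]$; the exponent of $w$ is $|w|$ divided by its smallest period. The critical exponent of an infinite word is the supremum of the exponents of its nonempty factors. *)

theory Defs
  imports Complex_Main "HOL-Library.Extended_Real" "HOL-Library.Omega_Words_Fun"
begin

function H :: "nat \<Rightarrow> nat" where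
  "H 0 = 0"
| "H (Suc n) = Suc n - H (H (H n))"
  by pat_completeness auto

lemma H_dom_le: "H_dom n \<Longrightarrow> H n \<le> n"
  by (induction rule: H.pinduct) (simp_all add: H.psimps)

termination
proof (relation "measure id")
  fix n
  assume d1: "H_dom n"
  then have l1: "H n \<le> n" by (rule H_dom_le)
  then show "(H n, Suc n) \<in> measure id" by simp
  assume d2: "H_dom (H n)"
  then have "H (H n) \<le> H n" by (rule H_dom_le)
  with l1 show "(H (H n), Suc n) \<in> measure id" by simp
qed auto

lemma H_le: "H n \<le> n"
  by (induction n rule: H.induct) simp_all

lemma HHH_le: "H (H (H n)) \<le> n"
  using H_le[of n] H_le[of "H n"] H_le[of "H (H n)"] by linarith

text \<open>The truncated subtraction in the recursion never truncates.\<close>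

lemma H_rec: "i \<ge> 1 \<Longrightarrow> int (H i) = int i - int (H (H (H (i - 1))))"
  using HHH_le[of "i - 1"] by (cases i) (auto)

definition S :: "nat \<Rightarrow> nat" where
  "S i = card {k. H k = i}"

lemma H_Suc_cases: "H (Suc n) = H n \<or> H (Suc n) = Suc (H n)"
proof (induction n rule: less_induct)
  case (less n)
  show ?case
  proof (cases n)
    case 0
    then show ?thesis by simp
  next
    case (Suc m)
    have step: "H (Suc x) = H x \<or> H (Suc x) = Suc (H x)" if "x \<le> m" for x
      using less.IH that Suc by simp
    have "H (H (H (Suc m))) = H (H (H m)) \<or> H (H (H (Suc m))) = Suc (H (H (H m)))"
      using step[of m] step[of "H m"] step[of "H (H m)"] H_le[of m] H_le[of "H m"] by fastforce
    moreover have "H (H (H m)) \<le> m" "H (H (H (Suc m))) \<le> Suc m" by (rule HHH_le)+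
    ultimately show ?thesis using Suc by auto
  qed
qed

lemma H_mono: "m \<le> n \<Longrightarrow> H m \<le> H n"
proof (rule lift_Suc_mono_le[of H])
  show "H n \<le> H (Suc n)" for n using H_Suc_cases[of n] by linarith
qed

lemma le_double_H: "k \<le> 2 * H k"
proof (cases k)
  case (Suc m)
  have "H (H (H m)) \<le> H k"
    using H_le[of "H (H m)"] H_le[of "H m"] H_mono[of m k] Suc by simp
  moreover have "H (H (H m)) \<le> m" by (rule HHH_le)
  ultimately show ?thesis using Suc by simp
qed simp

lemma finite_H_vimage: "finite {k. H k = i}"
  by (rule finite_subset[of _ "{..2 * i}"]) (use le_double_H in auto)

lemma H_surj: "\<exists>k. H k = i"
proof (induction i)
  case 0
  show ?case by (rule exI[of _ 0]) simp
next
  case (Suc i)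
  define M where "M = Max {k. H k = i}"
  have "H M = i" unfolding M_def using Max_in[OF finite_H_vimage[of i]] Suc by auto
  moreover have "H (Suc M) \<noteq> i"
    using Max_ge[OF finite_H_vimage[of i], of "Suc M"] by (auto simp: M_def)
  ultimately show ?case using H_Suc_cases[of M] by metis
qed

lemma H_Suc_Suc: "H n < H (Suc (Suc n))"
proof (rule ccontr)
  assume "\<not> ?thesis"
  then have e: "H (Suc (Suc n)) = H (Suc n)" "H (Suc n) = H n"
    using H_Suc_cases[of "Suc n"] H_Suc_cases[of n] by linarith+
  have "H (Suc (Suc n)) = Suc (Suc n) - H (H (H n))"
    using H.simps(2)[of "Suc n"] unfolding e(2) .
  moreover have "H (Suc n) = Suc n - H (H (H n))" by (rule H.simps(2))
  ultimately show False using e(1) HHH_le[of n] by linarith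
qed

lemma S_range: "S i \<in> {1, 2}"
proof -
  define m where "m = Min {k. H k = i}"
  have ne: "{k. H k = i} \<noteq> {}" using H_surj by auto
  have m: "H m = i" unfolding m_def using Min_in[OF finite_H_vimage ne] by auto
  have "{k. H k = i} \<subseteq> {m, Suc m}"
  proof
    fix k assume "k \<in> {k. H k = i}"
    then have k: "H k = i" by simp
    then have "m \<le> k" unfolding m_def by (simp add: finite_H_vimage)
    moreover have "\<not> Suc (Suc m) \<le> k"
      using H_mono[of "Suc (Suc m)" k] H_Suc_Suc[of m] m k by linarith
    ultimately show "k \<in> {m, Suc m}" by auto
  qed
  then have "card {k. H k = i} \<le> card {m, Suc m}" by (intro card_mono) auto
  moreover have "card {k. H k = i} > 0" by (simp add: card_gt_0_iff ne finite_H_vimage del: Collect_empty_eq)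
  ultimately show ?thesis by (auto simp: S_def)
qed

lemma S_prefix: "map S [0..<11] = [1, 2, 1, 1, 2, 2, 1, 2, 1, 1, 2]"
proof -
  have S_eq: "S i = length (filter (\<lambda>k. H k = i) [0..<21])" if "i \<le> 10" for i
  proof -
    have "{k. H k = i} = set (filter (\<lambda>k. H k = i) [0..<21])"
    proof (rule set_eqI)
      show "k \<in> {k. H k = i} \<longleftrightarrow> k \<in> set (filter (\<lambda>k. H k = i) [0..<21])" for k
        using le_double_H[of k] that by (simp del: upt_Suc) linarith
    qed
    then show ?thesis
      unfolding S_def by (simp only: distinct_card distinct_filter distinct_upt)
  qed
  have rec: "H n = n - H (H (H (n - 1)))" if "n > 0" for n
    using that by (cases n) simp_all
  have h1: "H 1 = 1" by simp
  have h1': "H (Suc 0) = Suc 0" by simp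
  have h2: "H 2 = 1" using rec[of 2] h1 by simp
  have h3: "H 3 = 2" using rec[of 3] h1 h2 by simp
  have h4: "H 4 = 3" using rec[of 4] h1 h2 h3 by simp
  have h5: "H 5 = 4" using rec[of 5] h2 h3 h4 by simp
  have h6: "H 6 = 4" using rec[of 6] h3 h4 h5 by simp
  have h7: "H 7 = 5" using rec[of 7] h3 h4 h6 by simp
  have h8: "H 8 = 5" using rec[of 8] h4 h5 h7 by simp
  have h9: "H 9 = 6" using rec[of 9] h4 h5 h8 by simp
  have h10: "H 10 = 7" using rec[of 10] h4 h6 h9 by simp
  have h11: "H 11 = 7" using rec[of 11] h5 h7 h10 by simp
  have h12: "H 12 = 8" using rec[of 12] h5 h7 h11 by simp
  have h13: "H 13 = 9" using rec[of 13] h5 h8 h12 by simp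
  have h14: "H 14 = 10" using rec[of 14] h6 h9 h13 by simp
  have h15: "H 15 = 10" using rec[of 15] h7 h10 h14 by simp
  have h16: "H 16 = 11" using rec[of 16] h7 h10 h15 by simp
  have h17: "H 17 = 12" using rec[of 17] h7 h11 h16 by simp
  have h18: "H 18 = 13" using rec[of 18] h8 h12 h17 by simp
  have h19: "H 19 = 13" using rec[of 19] h9 h13 h18 by simp
  have h20: "H 20 = 14" using rec[of 20] h9 h13 h19 by simp
  note h = h1 h2 h3 h4 h5 h6 h7 h8 h9 h10 h11 h12 h13 h14 h15 h16 h17 h18 h19 h20
  have upt: "[0..<11] = [0, 1, 2, 3, 4, 5, 6, 7, 8, 9, 10::nat]"
    by (simp add: upt_rec)
  have upt': "[0..<21] = [0, 1, 2, 3, 4, 5, 6, 7, 8, 9, 10,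
      11, 12, 13, 14, 15, 16, 17, 18, 19, 20::nat]"
    by (simp add: upt_rec)
  show ?thesis
    unfolding upt by (simp add: S_eq upt' h h1' del: H.simps(2) upt_Suc)
qed

text \<open>
  With \<open>p = length w\<close> both sides below are the empty word, so the length of a
  nonempty word is one of its periods; \<open>p = 0\<close> is excluded.
\<close>

definition has_period :: "'a list \<Rightarrow> nat \<Rightarrow> bool" where
  "has_period w p \<longleftrightarrow> 1 \<le> p \<and> p \<le> length w \<and> take (length w - p) w = drop p w"

definition exponent :: "'a list \<Rightarrow> real" where
  "exponent w = real (length w) / real (LEAST p. has_period w p)"

definition factors :: "'a word \<Rightarrow> 'a list set" where
  "factors x = {x [i \<rightarrow> j] | i j. i \<le> j}"

definition critical_exponent :: "'a word \<Rightarrow> ereal" where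
  "critical_exponent x = (SUP w \<in> factors x - {[]}. ereal (exponent w))"

lemma has_period_length: "w \<noteq> [] \<Longrightarrow> has_period w (length w)"
  by (simp add: has_period_def Suc_le_eq)

lemma ex1_alpha: "\<exists>!a::real. a ^ 3 = a ^ 2 + 1"
proof -
  have "\<exists>a\<ge>1. a \<le> 2 \<and> a ^ 3 - a ^ 2 = (1::real)"
    by (rule IVT) (simp_all)
  then obtain a :: real where a: "a ^ 3 = a ^ 2 + 1" by (auto simp: algebra_simps)
  have gt: "b > 1" if "b ^ 3 = b ^ 2 + 1" for b :: real
  proof (rule ccontr)
    assume "\<not> b > 1"
    then have "b ^ 2 * (b - 1) \<le> 0" by (intro mult_nonneg_nonpos) auto
    with that show False by (simp add: algebra_simps power2_eq_square power3_eq_cube)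
  qed
  show ?thesis
  proof (rule ex1I[of _ a], rule a)
    fix b :: real assume b: "b ^ 3 = b ^ 2 + 1"
    have "(b - a) * (b * (b - 1) + a * (a - 1) + a * b) = 0"
      using a b by (simp add: algebra_simps power2_eq_square power3_eq_cube)
    moreover have "b * (b - 1) + a * (a - 1) + a * b > 0"
      using gt[OF a] gt[OF b] by (intro add_pos_pos mult_pos_pos) auto
    ultimately show "b = a" by simp
  qed
qed

lemma critical_value_approx:
  fixes a :: real
  assumes "a ^ 3 = a ^ 2 + 1"
  shows "\<bar>(a ^ 2 + a + 5) / 3 - 2.8711567558605\<bar> < 5 / 10 ^ 14"
proof -
  define f where "f = (\<lambda>x::real. x ^ 2 * (x - 1))"
  have fa: "f a = 1" using assms by (simp add: f_def algebra_simps power2_eq_square power3_eq_cube)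
  have a1: "a > 1"
  proof (rule ccontr)
    assume "\<not> a > 1"
    then have "f a \<le> 0" unfolding f_def by (intro mult_nonneg_nonpos) auto
    with fa show False by simp
  qed
  have mono: "f x \<le> f y" if "1 \<le> x" "x \<le> y" for x y
    unfolding f_def using that by (intro mult_mono power_mono) auto
  define l u :: real where "l = 1.465571231876768" and "u = 1.465571231876769"
  have "f l < 1" "f u > 1" by (simp_all add: f_def l_def u_def power2_eq_square)
  then have lu: "l < a" "a < u"
    using mono[of a l] mono[of u a] fa a1 by (force simp: l_def u_def)+
  have "l ^ 2 \<le> a ^ 2" "a ^ 2 \<le> u ^ 2"
    using lu a1 by (auto intro!: power_mono simp: l_def)
  with lu show ?thesis by (simp add: l_def u_def power2_eq_square abs_less_iff)
qed

end

theory Submission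
  imports Defs
begin

text \<open>
  Let \<open>nar\<close> be the fixed point of \<open>3 \<mapsto> 31\<close>, \<open>1 \<mapsto> 2\<close>, \<open>2 \<mapsto> 3\<close>. The recursion for \<open>H\<close> says that
  \<open>H\<close> is a left inverse of the map \<open>pos\<close> sending \<open>i\<close> to the position where the image of the \<open>i\<close>th letter starts;
  hence \<open>S\<close> is \<open>1\<close> followed by the image of \<open>nar\<close> under \<open>3 \<mapsto> 2\<close>, \<open>1, 2 \<mapsto> 1\<close>, and the letters of
  \<open>nar\<close> can be read off from \<open>S\<close> with a delay of one letter.

  A maximal repetition of period \<open>p\<close> and length \<open>p + e\<close> in \<open>nar\<close> with \<open>e \<ge> 1\<close> is the image of a
  shorter one, followed by an extra common letter exactly if the letters breaking the shorter
  repetition are 2 and 3. These extra letters appear at every second step. After \<open>n\<close> steps from an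
  empty overlap this gives \<open>p \<ge> Nar n\<close> and \<open>3 e = Nar (n+2) + Nar (n+1) + 2 Nar n - c\<close>, where \<open>Nar\<close>
  is the Narayana sequence and \<open>c\<close> is 5 or 4 according to the parity of \<open>n\<close>. Starting from the
  period word 2 one gets \<open>p = Nar n\<close>. Up to the error term
  \<open>Nar (n+2) + Nar (n+1) - (\<alpha>\<^sup>2 + \<alpha>) Nar n\<close>, this bounds \<open>e / p\<close> by \<open>(\<alpha>\<^sup>2 + \<alpha> + 2) / 3\<close> and shows
  that the bound is approached; the error obeys a two-term recurrence that decreases a positive
  definite quadratic form.
\<close>

section \<open>The fixed point of \<open>3 \<mapsto> 31\<close>, \<open>1 \<mapsto> 2\<close>, \<open>2 \<mapsto> 3\<close>\<close>

definition pos :: "nat \<Rightarrow> nat" where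
  "pos i = Max {k. H k = i}"

text \<open>The letter is 1 where \<open>H\<close> stalls, so that k is not a value of
  \<open>pos\<close>. Otherwise k = \<open>pos (H k)\<close> starts the image of the letter at
  \<open>H k\<close>, which begins with 2 for the letter 1 and with 3 for the other two.\<close>

definition nar :: "nat \<Rightarrow> nat" where
  "nar k = (if H (Suc k) = H k then 1 else if H (Suc (H k)) = H (H k) then 2 else 3)"

lemma H_pos [simp]: "H (pos i) = i"
  unfolding pos_def using Max_in[OF finite_H_vimage[of i]] H_surj[of i] by auto

lemma le_pos: "H k = i \<Longrightarrow> k \<le> pos i"
  unfolding pos_def using Max_ge[OF finite_H_vimage[of i], of k] by simp

lemma H_Suc_pos [simp]: "H (Suc (pos i)) = Suc i"
  using H_Suc_cases[of "pos i"] le_pos[of "Suc (pos i)" i] by auto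

text \<open>By the recursion \<open>H\<close> stalls at k + 1 exactly if its third iterate increases
  at k. All increments being 0 or 1, each of the three applications must then increase.\<close>

lemma H_Suc_Suc_eq_iff:
  "H (Suc (Suc k)) = H (Suc k) \<longleftrightarrow>
    H (Suc k) \<noteq> H k \<and> H (Suc (H k)) \<noteq> H (H k) \<and> H (Suc (H (H k))) \<noteq> H (H (H k))"
proof -
  have "H (Suc (Suc k)) = H (Suc k) \<longleftrightarrow> H (H (H (Suc k))) = Suc (H (H (H k)))"
    using HHH_le[of k] HHH_le[of "Suc k"] H.simps(2)[of k] H.simps(2)[of "Suc k"] by linarith
  then show ?thesis
    using H_Suc_cases[of k] H_Suc_cases[of "H k"] H_Suc_cases[of "H (H k)"]
    by (metis n_not_Suc_n)
qed

lemma eq_pos_H: "nar k \<noteq> 1 \<Longrightarrow> k = pos (H k)"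
proof -
  assume "nar k \<noteq> 1"
  then have "H (Suc k) = Suc (H k)"
    using H_Suc_cases[of k] by (auto simp: nar_def split: if_splits)
  then have "\<not> Suc k \<le> pos (H k)"
    using H_mono[of "Suc k" "pos (H k)"] by auto
  then show ?thesis
    using le_pos[of k "H k"] by simp
qed

lemma nar_cases: "nar k = 1 \<or> nar k = 2 \<or> nar k = 3"
  by (simp add: nar_def)

lemma nar_pos: "nar (pos i) = (if nar i = 1 then 2 else 3)"
  by (simp add: nar_def del: H.simps(2))

lemma H_Suc_Suc_pos: "H (Suc (Suc (pos i))) = Suc i \<longleftrightarrow> nar i = 3"
  using H_Suc_Suc_eq_iff[of "pos i"] by (simp add: nar_def del: H.simps(2))

lemma pos_Suc_3: "nar i = 3 \<Longrightarrow> pos (Suc i) = Suc (Suc (pos i))"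
proof -
  assume "nar i = 3"
  then have "H (Suc (Suc (pos i))) = Suc i"
    by (simp add: H_Suc_Suc_pos del: H.simps(2))
  moreover have "H (Suc (Suc (Suc (pos i)))) > H (Suc (pos i))"
    by (rule H_Suc_Suc)
  ultimately have "nar (Suc (Suc (pos i))) \<noteq> 1"
    by (simp add: nar_def del: H.simps(2))
  from eq_pos_H[OF this] show ?thesis
    using \<open>H (Suc (Suc (pos i))) = Suc i\<close> by simp
qed

lemma nar_Suc_pos_3: "nar i = 3 \<Longrightarrow> nar (Suc (pos i)) = 1"
  using H_Suc_Suc_pos[of i] by (simp add: nar_def del: H.simps(2))

lemma pos_Suc_not_3: "nar i \<noteq> 3 \<Longrightarrow> pos (Suc i) = Suc (pos i)"
proof -
  assume "nar i \<noteq> 3"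
  then have "nar (Suc (pos i)) \<noteq> 1"
    using H_Suc_Suc_pos[of i] by (simp add: nar_def del: H.simps(2))
  from eq_pos_H[OF this] show ?thesis by (simp del: H.simps(2))
qed

lemma pos_Suc: "pos (Suc i) = pos i + (if nar i = 3 then 2 else 1)"
  by (simp add: pos_Suc_3 pos_Suc_not_3)

lemma strict_mono_pos: "strict_mono pos"
  by (simp add: strict_mono_Suc_iff pos_Suc)

lemma pos_mono: "m \<le> n \<Longrightarrow> pos m \<le> pos n"
  by (simp add: strict_mono_pos strict_mono_less_eq)

lemma pos_add_le: "pos i + k \<le> pos (i + k)"
  by (induction k) (simp_all add: pos_Suc)

lemma nar_0 [simp]: "nar 0 = 3"
  by (simp add: nar_def)

lemma pos_0 [simp]: "pos 0 = 0"
  using eq_pos_H[of 0] by simp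

lemma Suc_le_pos: "m \<ge> 1 \<Longrightarrow> Suc m \<le> pos m"
proof (induction m rule: dec_induct)
  case base
  then show ?case using pos_Suc[of 0] by simp
next
  case (step m)
  then show ?case using pos_Suc[of m] by simp
qed

lemma nar_eq_1D:
  assumes "nar k = 1"
  obtains m where "k = Suc m" "nar m = 3"
proof (cases k)
  case 0
  then show ?thesis using assms by simp
next
  case (Suc m)
  have "H (Suc (Suc m)) = H (Suc m)"
    using assms Suc by (simp add: nar_def del: H.simps(2) split: if_splits)
  then have *: "H (Suc m) \<noteq> H m" "H (Suc (H m)) \<noteq> H (H m)"
    by (simp_all add: H_Suc_Suc_eq_iff del: H.simps(2))
  then have "nar m = 3"
    by (simp add: nar_def del: H.simps(2))
  then show ?thesis using that Suc by simp
qed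

lemma nar_Suc_of_1: "nar k = 1 \<Longrightarrow> nar (Suc k) \<noteq> 1"
  using nar_eq_1D[of "Suc k"] by fastforce

lemma nar_eq_2_iff: "nar k = 2 \<longleftrightarrow> (\<exists>i. k = pos i \<and> nar i = 1)"
  using eq_pos_H[of k] nar_pos nar_cases[of k] by (metis numeral_eq_iff one_eq_numeral_iff semiring_norm(85) semiring_norm(89))

lemma nar_Suc_of_2: "nar k = 2 \<Longrightarrow> nar (Suc k) = 3"
proof -
  assume "nar k = 2"
  then obtain i where i: "k = pos i" "nar i = 1" by (auto simp: nar_eq_2_iff)
  then have "Suc k = pos (Suc i)" by (simp add: pos_Suc)
  then show ?thesis using nar_pos[of "Suc i"] nar_Suc_of_1[OF i(2)] by simp
qed

lemma nar_eq_2D: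
  assumes "nar k = 2"
  obtains m where "k = Suc m" "nar m = 1"
proof -
  from assms obtain i where i: "k = pos i" "nar i = 1" by (auto simp: nar_eq_2_iff)
  from i(2) obtain j where j: "i = Suc j" "nar j = 3" by (rule nar_eq_1D)
  then have "k = Suc (Suc (pos j))" using i(1) by (simp add: pos_Suc_3)
  then show ?thesis using that nar_Suc_pos_3[OF j(2)] by simp
qed

text \<open>Length form of X^3 = X^2 + 1: the third image of each letter is one letter longer than
  its second image.\<close>

lemma pos_pos_pos: "pos (pos (pos i)) = pos (pos i) + i"
proof (induction i)
  case 0
  then show ?case by simp
next
  case (Suc i)
  consider "nar i = 1" | "nar i = 2" | "nar i = 3" using nar_cases by auto
  then show ?case
  proof cases
    case 1
    then show ?thesis using Suc by (simp add: pos_Suc nar_pos)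
  next
    case 2
    then show ?thesis using Suc by (simp add: pos_Suc nar_pos nar_Suc_pos_3)
  next
    case 3
    have "nar (Suc (Suc (pos (pos i)))) = 2"
      using nar_pos[of "Suc (pos i)"] nar_Suc_pos_3[OF 3] 3 by (simp add: pos_Suc nar_pos)
    then show ?thesis using Suc 3 by (simp add: pos_Suc nar_pos nar_Suc_pos_3)
  qed
qed

lemma S_0: "S 0 = 1"
proof -
  have "{k. H k = 0} = {0}" using le_pos[of _ 0] by auto
  then show ?thesis by (simp add: S_def)
qed

lemma S_Suc: "S (Suc i) = (if nar i = 3 then 2 else 1)"
proof -
  have "{k. H k = Suc i} = {Suc (pos i)..pos (Suc i)}"
  proof (rule set_eqI, safe)
    fix k assume k: "H k = Suc i"
    have "\<not> k \<le> pos i" using H_mono[of k "pos i"] k by auto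
    then show "k \<in> {Suc (pos i)..pos (Suc i)}" using le_pos[OF k] by simp
  next
    fix k assume "k \<in> {Suc (pos i)..pos (Suc i)}"
    then show "H k = Suc i"
      using H_mono[of "Suc (pos i)" k] H_mono[of k "pos (Suc i)"] by (simp del: H.simps(2))
  qed
  then show ?thesis by (simp add: S_def pos_Suc)
qed

section \<open>Repetitions in the fixed point\<close>

definition run :: "nat \<Rightarrow> nat \<Rightarrow> nat \<Rightarrow> bool" where
  "run i p e \<longleftrightarrow> (\<forall>k<e. nar (i + k) = nar (i + p + k)) \<and> nar (i + e) \<noteq> nar (i + p + e)"

text \<open>The image of 1 starts with 2, those of 2 and 3 with 3, so this decides whether the
  images of the two breaking letters share their first letter.\<close>

definition mismatch_no_1 :: "nat \<Rightarrow> nat \<Rightarrow> nat \<Rightarrow> bool" where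
  "mismatch_no_1 i p e \<longleftrightarrow> nar (i + e) \<noteq> 1 \<and> nar (i + p + e) \<noteq> 1"

lemma run_unique: "run i p e \<Longrightarrow> run i p e' \<Longrightarrow> e = e'"
  unfolding run_def by (metis linorder_neqE_nat)

lemma pos_shift:
  assumes "\<And>k. k < e \<Longrightarrow> nar (i + k) = nar (i + p + k)" "k \<le> e"
  shows "pos (i + p + k) + pos i = pos (i + k) + pos (i + p)"
  using assms(2)
proof (induction k)
  case (Suc k)
  then show ?case using assms(1)[of k] by (simp add: pos_Suc)
qed simp

lemma nar_pos_shift:
  assumes "\<And>k. k < e \<Longrightarrow> nar (i + k) = nar (i + p + k)" "pos i + m < pos (i + e)"
  shows "nar (pos i + m) = nar (pos (i + p) + m)"
  using assms
proof (induction e)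
  case (Suc e)
  have sh: "pos (i + p + e) + pos i = pos (i + e) + pos (i + p)"
    by (rule pos_shift[of "Suc e"]) (use Suc.prems in auto)
  have xe: "nar (i + e) = nar (i + p + e)" using Suc.prems by simp
  show ?case
  proof (cases "pos i + m < pos (i + e)")
    case True
    then show ?thesis using Suc by simp
  next
    case False
    have "pos i + m < pos (i + e) + (if nar (i + e) = 3 then 2 else 1)"
      using Suc.prems(2) by (simp add: pos_Suc)
    then consider "pos i + m = pos (i + e)" | "pos i + m = Suc (pos (i + e))" "nar (i + e) = 3"
      using False by (cases "nar (i + e) = 3") (simp_all, linarith)
    then show ?thesis
    proof cases
      case 1
      moreover have "pos (i + p) + m = pos (i + p + e)" using 1 sh by simp
      ultimately show ?thesis using xe by (simp add: nar_pos)
    next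
      case 2
      moreover have "pos (i + p) + m = Suc (pos (i + p + e))" using 2 sh by simp
      ultimately show ?thesis using xe nar_Suc_pos_3[of "i + e"] nar_Suc_pos_3[of "i + p + e"] by simp
    qed
  qed
qed simp

text \<open>A mismatch with a 1 becomes 2 against 3. A mismatch of 2 and 3 yields a common 3 and
  then a 1 on one side only, so the two types alternate.\<close>

lemma run_image:
  assumes "run i p e"
  defines "q \<equiv> pos (i + p) - pos i"
    and "d \<equiv> pos (i + e) - pos i + (if mismatch_no_1 i p e then 1 else 0)"
  shows "run (pos i) q d" "mismatch_no_1 (pos i) q d \<longleftrightarrow> \<not> mismatch_no_1 i p e"
proof -
  have m: "nar (i + k) = nar (i + p + k)" if "k < e" for k using assms(1) that by (simp add: run_def)
  have ne: "nar (i + e) \<noteq> nar (i + p + e)" using assms(1) by (simp add: run_def)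
  have q: "pos i + q = pos (i + p)" using pos_mono[of i "i + p"] by (simp add: q_def)
  have sh: "pos (i + p + e) + pos i = pos (i + e) + pos (i + p)" by (rule pos_shift[of e]) (use m in auto)
  have fe: "pos i \<le> pos (i + e)" by (rule pos_mono) simp
  have eq: "nar (pos i + k) = nar (pos i + q + k)" if "k < pos (i + e) - pos i" for k
    using nar_pos_shift[of e i p k] m that unfolding q by auto
  have "run (pos i) q d \<and> (mismatch_no_1 (pos i) q d \<longleftrightarrow> \<not> mismatch_no_1 i p e)"
  proof (cases "mismatch_no_1 i p e")
    case False
    then have d: "d = pos (i + e) - pos i" by (simp add: d_def)
    have *: "pos i + d = pos (i + e)" "pos i + q + d = pos (i + p + e)" using d fe sh q by simp_all
    show ?thesis
      using eq False ne by (auto simp: run_def mismatch_no_1_def * nar_pos d[symmetric])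
  next
    case True
    then have d: "d = Suc (pos (i + e) - pos i)" by (simp add: d_def)
    have *: "pos i + d = Suc (pos (i + e))" "pos i + q + d = Suc (pos (i + p + e))"
      using d fe sh q by simp_all
    have xs: "nar (pos (i + e)) = nar (pos (i + p + e))"
      using True by (simp add: mismatch_no_1_def nar_pos)
    have e1: "nar (pos i + k) = nar (pos i + q + k)" if "k < d" for k
    proof (cases "k < pos (i + e) - pos i")
      case False
      then have "k = pos (i + e) - pos i" using that d by simp
      then have "pos i + k = pos (i + e)" "pos i + q + k = pos (i + p + e)" using fe sh q by simp_all
      then show ?thesis using xs by simp
    qed (rule eq)
    consider "nar (i + e) = 3" "nar (i + p + e) = 2" | "nar (i + e) = 2" "nar (i + p + e) = 3"
      using ne True nar_cases[of "i + e"] nar_cases[of "i + p + e"] by (auto simp: mismatch_no_1_def)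
    then have "(nar (pos i + d) = 1) \<noteq> (nar (pos i + q + d) = 1)"
    proof cases
      case 1
      \<comment> \<open>After the image 3 of a 2 a new image starts, and no image starts with
        1.\<close>
      have "Suc (pos (i + p + e)) = pos (Suc (i + p + e))" using 1 by (simp add: pos_Suc)
      then show ?thesis using 1 nar_pos[of "Suc (i + p + e)"] by (simp add: * nar_Suc_pos_3)
    next
      case 2
      have "Suc (pos (i + e)) = pos (Suc (i + e))" using 2 by (simp add: pos_Suc)
      then show ?thesis using 2 nar_pos[of "Suc (i + e)"] by (simp add: * nar_Suc_pos_3)
    qed
    then show ?thesis using True e1 by (auto simp: run_def mismatch_no_1_def)
  qed
  then show "run (pos i) q d" "mismatch_no_1 (pos i) q d \<longleftrightarrow> \<not> mismatch_no_1 i p e" by auto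
qed

lemma ex_run_of_mismatch:
  assumes "nar (i + k) \<noteq> nar (i + p + k)"
  shows "\<exists>e. run i p e"
proof -
  define e where "e = (LEAST k. nar (i + k) \<noteq> nar (i + p + k))"
  have "nar (i + e) \<noteq> nar (i + p + e)" unfolding e_def by (rule LeastI) (rule assms)
  moreover have "nar (i + k) = nar (i + p + k)" if "k < e" for k
    using not_less_Least[OF that[unfolded e_def]] by simp
  ultimately show ?thesis by (auto simp: run_def)
qed

lemma ex_nar_eq_3: "\<exists>m\<ge>i. nar m = 3"
  using nar_cases[of i] nar_cases[of "Suc i"] nar_Suc_of_1[of i] nar_Suc_of_2[of i] nar_Suc_of_2[of "Suc i"]
  by (metis le_SucI order_refl)

lemma pos_preimage_period:
  assumes "nar i \<noteq> 1" "nar (i + p) \<noteq> 1" "p \<ge> 1"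
  obtains j q where "i = pos j" "i + p = pos (j + q)" "q \<ge> 1"
proof -
  have i: "i = pos (H i)" and ip: "i + p = pos (H (i + p))" using assms eq_pos_H by auto
  have "H i < H (i + p)"
    using assms(3) i ip strict_mono_less[OF strict_mono_pos, of "H i" "H (i + p)"] by linarith
  then show ?thesis using that[of "H i" "H (i + p) - H i"] i ip by simp
qed

text \<open>Eventual periodicity would descend through the substitution to ever smaller periods.\<close>

lemma ex_run: "p \<ge> 1 \<Longrightarrow> \<exists>e. run i p e"
proof (induction p arbitrary: i rule: less_induct)
  case (less p)
  show ?case
  proof (rule ccontr)
    assume "\<nexists>e. run i p e"
    then have eq: "nar (i + k) = nar (i + p + k)" for k using ex_run_of_mismatch by blast
    \<comment> \<open>The image of a 3 has two letters, which makes the preimage period strictly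
      smaller.\<close>
    obtain m where m: "m \<ge> i" "nar m = 3" using ex_nar_eq_3 by blast
    have fm: "pos m \<ge> i" using m(1) strict_mono_imp_increasing[OF strict_mono_pos, of m] by simp
    have eq': "nar k = nar (k + p)" if "k \<ge> i" for k
    proof -
      have "i + (k - i) = k" "i + p + (k - i) = k + p" using that by simp_all
      then show ?thesis using eq[of "k - i"] by metis
    qed
    have "nar (pos m) = 3" using m by (simp add: nar_pos)
    then obtain j q where jq: "pos m = pos j" "pos m + p = pos (j + q)" "q \<ge> 1"
      using pos_preimage_period[of "pos m" p] eq'[OF fm] less.prems by auto
    have jm: "j = m" using jq(1) strict_mono_eq[OF strict_mono_pos] by simp
    have "pos (Suc m) + (q - 1) \<le> pos (Suc m + (q - 1))" by (rule pos_add_le)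
    then have "Suc (Suc (pos m)) + (q - 1) \<le> pos m + p"
      using jq(2,3) by (simp add: pos_Suc_3[OF m(2)] jm)
    then have "q < p" by simp
    from less.IH[OF this jq(3), of m] obtain e where "run m q e" by blast
    moreover have "pos (m + q) - pos m = p" using jq(2) unfolding jm by simp
    ultimately obtain d where "run (pos m) p d" using run_image(1) by metis
    then have "nar (pos m + d) \<noteq> nar (pos m + p + d)" by (simp add: run_def)
    moreover have "nar (pos m + d) = nar (pos m + d + p)" by (rule eq') (use fm in simp)
    moreover have "pos m + d + p = pos m + p + d" by simp
    ultimately show False by metis
  qed
qed


section \<open>Lengths of overlaps and periods under the substitution\<close>

fun Nar :: "nat \<Rightarrow> nat" where
  "Nar 0 = 1"
| "Nar (Suc 0) = 1"
| "Nar (Suc (Suc 0)) = 2"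
| "Nar (Suc (Suc (Suc n))) = Nar (Suc (Suc n)) + Nar n"

text \<open>\<open>level n i p e\<close>: the overlap (the \<open>e\<close> repeated letters), its image under the substitution
  and its second image have the lengths that arise after \<open>n\<close> steps from an empty overlap. These three lengths determine all later ones by \<open>pos_pos_pos\<close>; likewise for the
  period in \<open>wide\<close>.\<close>

definition level :: "nat \<Rightarrow> nat \<Rightarrow> nat \<Rightarrow> nat \<Rightarrow> bool" where
  "level n i p e \<longleftrightarrow> run i p e \<and> (mismatch_no_1 i p e \<longleftrightarrow> even n) \<and>
    3 * e + (if even n then 5 else 4) = Nar (n + 2) + Nar (n + 1) + 2 * Nar n \<and>
    3 * pos (i + e) + (if even n then 7 else 5) = 3 * pos i + Nar (n + 3) + Nar (n + 2) + 2 * Nar (n + 1) \<and>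
    3 * pos (pos (i + e)) + (if even n then 11 else 7)
      = 3 * pos (pos i) + Nar (n + 4) + Nar (n + 3) + 2 * Nar (n + 2)"

definition wide :: "nat \<Rightarrow> nat \<Rightarrow> nat \<Rightarrow> bool" where
  "wide n i p \<longleftrightarrow> Nar n \<le> p \<and> pos i + Nar (n + 1) \<le> pos (i + p) \<and> pos (pos i) + Nar (n + 2) \<le> pos (pos (i + p))"

lemma level_0:
  assumes "run i p 0" "mismatch_no_1 i p 0"
  shows "level 0 i p 0"
  using assms by (simp add: level_def numeral_eq_Suc)

text \<open>The period word starts with 2 or 3, whose second images 31 and 312 have at least
  \<open>Nar 2\<close> = 2 letters; the second image of 1 is just 3.\<close>

lemma wide_0:
  assumes "nar i \<noteq> 1" "p \<ge> 1"
  shows "wide 0 i p"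
proof -
  obtain r where r: "p = Suc r" using assms(2) by (cases p) auto
  have "pos (pos i) + 2 \<le> pos (pos (Suc i))"
    using assms(1) nar_cases[of i] by (auto simp: pos_Suc nar_pos nar_Suc_pos_3)
  also have "\<dots> \<le> pos (pos (i + p))" by (intro pos_mono) (simp add: r)
  finally have "pos (pos i) + 2 \<le> pos (pos (i + p))" .
  moreover have "pos i + 1 \<le> pos (i + p)" using pos_add_le[of i p] assms(2) by simp
  ultimately show ?thesis using assms(2) by (simp add: wide_def numeral_eq_Suc)
qed

lemma level_image:
  assumes "level n i p e"
  defines "q \<equiv> pos (i + p) - pos i"
    and "d \<equiv> pos (i + e) - pos i + (if mismatch_no_1 i p e then 1 else 0)"
  shows "level (Suc n) (pos i) q d"
proof -
  have r: "run i p e" and m: "mismatch_no_1 i p e \<longleftrightarrow> even n"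
    and e0: "3 * e + (if even n then 5 else 4) = Nar (n + 2) + Nar (n + 1) + 2 * Nar n"
    and e1: "3 * pos (i + e) + (if even n then 7 else 5)
      = 3 * pos i + Nar (n + 3) + Nar (n + 2) + 2 * Nar (n + 1)"
    and e2: "3 * pos (pos (i + e)) + (if even n then 11 else 7)
      = 3 * pos (pos i) + Nar (n + 4) + Nar (n + 3) + 2 * Nar (n + 2)"
    using assms(1) by (simp_all add: level_def)
  have r': "run (pos i) q d" and m': "mismatch_no_1 (pos i) q d \<longleftrightarrow> even (Suc n)"
    using run_image[OF r] m by (simp_all add: q_def d_def)
  have le: "pos i \<le> pos (i + e)" by (rule pos_mono) simp
  have rec: "Nar (n + 5) = Nar (n + 4) + Nar (n + 2)" "Nar (n + 4) = Nar (n + 3) + Nar (n + 1)"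
    "Nar (n + 3) = Nar (n + 2) + Nar n" by (simp_all add: numeral_eq_Suc)
  have N: "Suc n + 1 = n + 2" "Suc n + 2 = n + 3" "Suc n + 3 = n + 4" "Suc n + 4 = n + 5"
    "Nar (Suc n) = Nar (n + 1)" by simp_all
  note fff = pos_pos_pos[of i] pos_pos_pos[of "i + e"]
  show ?thesis
  proof (cases "even n")
    case True
    then have fd: "pos i + d = Suc (pos (i + e))" using m le by (simp add: d_def)
    \<comment> \<open>The extra common letter is a 3 with images 31 and 312, so the three lengths
      grow by 1, 2, 3 and the constants 7, 11, 5 + 11 drop by 3, 6, 9.\<close>
    have x3: "nar (pos (i + e)) = 3" using True m by (simp add: mismatch_no_1_def nar_pos)
    have f1: "pos (pos i + d) = pos (pos (i + e)) + 2" using x3 by (simp add: fd pos_Suc)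
    have f2: "pos (pos (pos i + d)) = pos (pos (pos (i + e))) + 3"
      using x3 by (simp add: fd pos_Suc nar_pos nar_Suc_pos_3)
    have "3 * d = 3 * (pos (i + e) - pos i) + 3" using True m by (simp add: d_def)
    then have "3 * d + 4 = Nar (n + 3) + Nar (n + 2) + 2 * Nar (n + 1)"
      using e1 True le by simp
    moreover have "3 * pos (pos i + d) + 5 = 3 * pos (pos i) + Nar (n + 4) + Nar (n + 3) + 2 * Nar (n + 2)"
      using e2 True f1 by simp
    moreover have "3 * pos (pos (pos i + d)) + 7
        = 3 * pos (pos (pos i)) + Nar (n + 5) + Nar (n + 4) + 2 * Nar (n + 3)"
      using e0 e2 True f2 fff rec by simp
    ultimately show ?thesis using r' m' True unfolding level_def N by simp
  next
    case False
    then have fd: "pos i + d = pos (i + e)" using m le by (simp add: d_def)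
    \<comment> \<open>Without an extra letter the constants 4, 5, 7 turn into 5, 7, 4 + 7.\<close>
    have "3 * d + 5 = Nar (n + 3) + Nar (n + 2) + 2 * Nar (n + 1)"
      using e1 False fd by simp
    moreover have "3 * pos (pos i + d) + 7 = 3 * pos (pos i) + Nar (n + 4) + Nar (n + 3) + 2 * Nar (n + 2)"
      using e2 False fd by simp
    moreover have "3 * pos (pos (pos i + d)) + 11
        = 3 * pos (pos (pos i)) + Nar (n + 5) + Nar (n + 4) + 2 * Nar (n + 3)"
      using e0 e2 False fff rec fd by simp
    ultimately show ?thesis using r' m' False unfolding level_def N by simp
  qed
qed

lemma wide_image:
  assumes "wide n i p"
  shows "wide (Suc n) (pos i) (pos (i + p) - pos i)"
proof -
  have "pos i \<le> pos (i + p)" by (rule pos_mono) simp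
  moreover have "Nar (n + 3) = Nar (n + 2) + Nar n" by (simp add: numeral_eq_Suc)
  moreover have "Suc n + 1 = n + 2" "Suc n + 2 = n + 3" "Nar (Suc n) = Nar (n + 1)" by simp_all
  ultimately show ?thesis
    using assms pos_pos_pos[of i] pos_pos_pos[of "i + p"] unfolding wide_def by (simp add: le_diff_conv2)
qed

section \<open>Desubstituting maximal repetitions\<close>

definition left_maximal :: "nat \<Rightarrow> nat \<Rightarrow> bool" where
  "left_maximal i p \<longleftrightarrow> (\<forall>m. i = Suc m \<longrightarrow> nar m \<noteq> nar (m + p))"

text \<open>Images of equal letters end in equal letters, so a common letter to the left of the
  preimages would give one to the left of the images.\<close>

lemma left_maximal_preimage:
  assumes "left_maximal (pos j) p" "pos j + p = pos (j + q)"
  shows "left_maximal j q"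
  unfolding left_maximal_def
proof (intro allI impI notI)
  fix m assume m: "j = Suc m" and eq: "nar m = nar (m + q)"
  consider "nar m = 3" | "nar m \<noteq> 3" by auto
  then show False
  proof cases
    case 1
    then have "pos j = Suc (Suc (pos m))" "pos (j + q) = Suc (Suc (pos (m + q)))"
      using m eq by (simp_all add: pos_Suc)
    then have "Suc (pos m) + p = Suc (pos (m + q))" using assms(2) by simp
    then have "nar (Suc (pos m)) = nar (Suc (pos m) + p)"
      using nar_Suc_pos_3[of m] nar_Suc_pos_3[of "m + q"] 1 eq by simp
    then show False using assms(1) \<open>pos j = Suc (Suc (pos m))\<close> by (auto simp: left_maximal_def)
  next
    case 2
    then have "pos j = Suc (pos m)" "pos (j + q) = Suc (pos (m + q))"
      using m eq by (simp_all add: pos_Suc)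
    then have "pos m + p = pos (m + q)" using assms(2) by simp
    then have "nar (pos m) = nar (pos m + p)" using eq by (simp add: nar_pos)
    then show False using assms(1) \<open>pos j = Suc (pos m)\<close> by (auto simp: left_maximal_def)
  qed
qed

text \<open>A 1 always follows a 3, so a repetition starting with 1 extends to the left. A nonempty
  left maximal overlap therefore starts where an image starts.\<close>

lemma left_maximal_nar_ne_1:
  assumes "left_maximal i p" "nar i = nar (i + p)"
  shows "nar i \<noteq> 1"
proof
  assume 1: "nar i = 1"
  then obtain m where m: "i = Suc m" "nar m = 3" by (rule nar_eq_1D)
  moreover obtain m' where "i + p = Suc m'" "nar m' = 3" using 1 assms(2) nar_eq_1D by metis
  ultimately show False using assms(1) by (auto simp: left_maximal_def)
qed

text \<open>Desubstituting a maximal repetition ends at an empty overlap followed by a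
  mismatch of 2 against 3, since only this mismatch makes the overlap grow.\<close>

lemma ex_level:
  assumes "run i p e" "p \<ge> 1" "left_maximal i p" "e \<ge> 1 \<or> mismatch_no_1 i p e"
  shows "\<exists>n. level n i p e \<and> wide n i p"
  using assms
\<comment> \<open>The period alone need not shrink: it keeps its length if the period word of the
  preimage contains no 3.\<close>
proof (induction "i + p" arbitrary: i p e rule: less_induct)
  case less
  show ?case
  proof (cases "e = 0")
    case True
    then have "level 0 i p e" "wide 0 i p"
      using less.prems level_0[of i p] wide_0[of i p] by (auto simp: mismatch_no_1_def)
    then show ?thesis by blast
  next
    case False
    then have eq: "nar i = nar (i + p)" using less.prems(1) by (auto simp: run_def)
    then obtain j q where jq: "i = pos j" "i + p = pos (j + q)" "q \<ge> 1"
      using pos_preimage_period[of i p] left_maximal_nar_ne_1[OF less.prems(3)] less.prems(2) by metis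
    have q: "pos (j + q) - pos j = p" using jq by simp
    obtain c where c: "run j q c" using ex_run[OF jq(3)] by blast
    have e: "e = pos (j + c) - pos j + (if mismatch_no_1 j q c then 1 else 0)"
      by (rule run_unique[OF less.prems(1)]) (use run_image(1)[OF c] q jq(1) in simp)
    have "j + q < i + p" using jq Suc_le_pos[of "j + q"] by simp
    moreover have "left_maximal j q"
      using left_maximal_preimage less.prems(3) jq by simp
    \<comment> \<open>If c = 0, the nonempty overlap e can only consist of the extra letter.\<close>
    moreover have "c \<ge> 1 \<or> mismatch_no_1 j q c" using e False by (cases c) (auto split: if_splits)
    ultimately obtain n where n: "level n j q c" "wide n j q"
      using less.hyps c jq(3) by blast
    then show ?thesis
      using level_image[OF n(1)] wide_image[OF n(2)] unfolding q e[symmetric]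
      using jq(1) by blast
  qed
qed

text \<open>Extending on both sides with the same period makes the repetition maximal and only
  lengthens the overlap, so \<open>ex_level\<close> applies.\<close>

lemma repetition_bound:
  assumes "p \<ge> 1" "\<And>k. k < e \<Longrightarrow> nar (i + k) = nar (i + p + k)"
  obtains "e = 0" | n where "Nar n \<le> p" "3 * e + (if even n then 5 else 4) \<le> Nar (n + 2) + Nar (n + 1) + 2 * Nar n"
proof -
  define Q where "Q = (\<lambda>j. j \<le> i \<and> (\<forall>m. j \<le> m \<longrightarrow> m < i + e \<longrightarrow> nar m = nar (m + p)))"
  define j where "j = (LEAST j. Q j)"
  have "Q i" unfolding Q_def using assms(2) by (metis add.assoc add.commute le_Suc_ex nat_add_left_cancel_less order_refl)
  then have Qj: "Q j" unfolding j_def by (rule LeastI)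
  have lm: "left_maximal j p"
    unfolding left_maximal_def
  proof (intro allI impI notI)
    fix m assume m: "j = Suc m" "nar m = nar (m + p)"
    then have "Q m" using Qj unfolding Q_def by (metis Suc_leD Suc_leI le_neq_implies_less)
    then have "j \<le> m" unfolding j_def by (rule Least_le)
    then show False using m by simp
  qed
  obtain d where d: "run j p d" using ex_run[OF assms(1)] by blast
  have "\<not> d < i - j + e"
    using Qj d unfolding Q_def run_def by (auto simp: add_ac)
  then have de: "e \<le> d" by simp
  show ?thesis
  proof (cases "e = 0")
    case False
    then obtain n where "level n j p d" "wide n j p"
      using ex_level[OF d assms(1) lm] de by auto
    then show ?thesis using that(2)[of n] de by (simp add: level_def wide_def split: if_splits)
  qed (rule that(1))
qed

text \<open>Sharpness: the lower bounds of \<open>wide\<close> are attained by the iterated images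
  of one starting repetition.\<close>

lemma ex_level_Nar: "\<exists>i e. level n i (Nar n) e \<and> pos i + Nar (n + 1) = pos (i + Nar n) \<and> pos (pos i) + Nar (n + 2) = pos (pos (i + Nar n))"
proof (induction n)
  case 0
  \<comment> \<open>The word \<open>nar\<close> begins with 3123. Position 2 carries the period word
    2, whose iterated images 2, 3, 31 have lengths \<open>Nar 0\<close>, \<open>Nar 1\<close>,
    \<open>Nar 2\<close>.\<close>
  have x1: "nar (Suc 0) = 1" and f1: "pos (Suc 0) = 2" using nar_Suc_pos_3[of 0] pos_Suc[of 0] by simp_all
  have x2: "nar 2 = 2" using nar_pos[of "Suc 0"] x1 f1 by simp
  have f2: "pos 2 = 3" using pos_Suc[of "Suc 0"] f1 x1 by (simp add: numeral_eq_Suc)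
  have x3: "nar 3 = 3" using nar_pos[of 2] f2 x2 by simp
  have f3: "pos 3 = 4" using pos_Suc[of 2] f2 x2 by (simp add: numeral_eq_Suc)
  have f4: "pos 4 = 6" using pos_Suc[of 3] f3 x3 by (simp add: numeral_eq_Suc)
  have "level 0 2 (Nar 0) 0"
    by (rule level_0) (use x2 x3 in \<open>simp_all add: run_def mismatch_no_1_def eval_nat_numeral\<close>)
  moreover have "pos 2 + Nar (0 + 1) = pos (2 + Nar 0)" "pos (pos 2) + Nar (0 + 2) = pos (pos (2 + Nar 0))"
    using f2 f3 f4 by (simp_all add: eval_nat_numeral)
  ultimately show ?case by blast
next
  case (Suc n)
  then obtain i e where h: "level n i (Nar n) e" "pos i + Nar (n + 1) = pos (i + Nar n)"
    "pos (pos i) + Nar (n + 2) = pos (pos (i + Nar n))" by blast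
  have q: "pos (i + Nar n) - pos i = Nar (Suc n)" using h(2) by simp
  obtain d where "level (Suc n) (pos i) (Nar (Suc n)) d" using level_image[OF h(1)] unfolding q by blast
  moreover have "pos (pos i) + Nar (Suc n + 1) = pos (pos i + Nar (Suc n))"
    using h by (simp add: eval_nat_numeral)
  moreover have "pos (pos (pos i)) + Nar (Suc n + 2) = pos (pos (pos i + Nar (Suc n)))"
    using h pos_pos_pos[of i] pos_pos_pos[of "i + Nar n"] by (simp add: eval_nat_numeral)
  ultimately show ?case by blast
qed

lemma Nar_pos: "0 < Nar n"
  by (induction n rule: Nar.induct) simp_all

lemma le_Nar: "n \<le> Nar n"
proof (induction n rule: Nar.induct)
  case (4 n)
  then show ?case using Nar_pos[of n] by simp
qed simp_all

section \<open>The quadratic estimate\<close>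

text \<open>The remaining two roots of \<open>X\<^sup>3 = X\<^sup>2 + 1\<close> are those of \<open>X\<^sup>2 + (a - 1) X + a (a - 1)\<close>, which
  governs the recurrence of \<open>err\<close>; \<open>energy\<close> is the associated norm form, scaled by
  \<open>a (a - 1) < 1\<close> at each step.\<close>

definition err :: "real \<Rightarrow> nat \<Rightarrow> real" where
  "err a n = real (Nar (n + 2)) + real (Nar (n + 1)) - (a\<^sup>2 + a) * real (Nar n)"

definition energy :: "real \<Rightarrow> nat \<Rightarrow> real" where
  "energy a n = (err a (Suc n))\<^sup>2 + (a - 1) * err a (Suc n) * err a n + a * (a - 1) * (err a n)\<^sup>2"

context
  fixes a :: real
  assumes a: "a ^ 3 = a ^ 2 + 1"
begin

lemma a_bounds: "1.4655 < a" "a < 1.4656"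
proof -
  define h where "h = (\<lambda>t::real. t ^ 2 * (t - 1))"
  have ha: "h a = 1" using a by (simp add: h_def algebra_simps power2_eq_square power3_eq_cube)
  have a1: "a > 1"
  proof (rule ccontr)
    assume "\<not> a > 1"
    then have "h a \<le> 0" unfolding h_def by (intro mult_nonneg_nonpos) auto
    with ha show False by simp
  qed
  have mono: "h s \<le> h t" if "1 \<le> s" "s \<le> t" for s t
    unfolding h_def using that by (intro mult_mono power_mono) auto
  have "h 1.4655 < 1" "h 1.4656 > 1" by (simp_all add: h_def power2_eq_square)
  then show "1.4655 < a" "a < 1.4656"
    using mono[of a "1.4655"] mono[of "1.4656" a] ha a1 by force+
qed

lemma a_square_bounds: "2.1476 < a\<^sup>2" "a\<^sup>2 < 2.148"
proof -
  have "1.4655\<^sup>2 < a\<^sup>2" "a\<^sup>2 < 1.4656\<^sup>2"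
    using a_bounds by (auto intro!: power_strict_mono)
  then show "2.1476 < a\<^sup>2" "a\<^sup>2 < 2.148" by (simp_all add: power2_eq_square)
qed

text \<open>X^2 + X - (a^2 + a) vanishes at X = a, so the component of \<open>Nar\<close> along the
  root a drops out.\<close>

lemma err_rec: "err a (Suc (Suc n)) = - (a - 1) * err a (Suc n) - a * (a - 1) * err a n"
proof -
  define u v w where "u = real (Nar n)" and "v = real (Nar (Suc n))" and "w = real (Nar (Suc (Suc n)))"
  have g0: "err a n = w + v - (a\<^sup>2 + a) * u"
    and g1: "err a (Suc n) = (w + u) + w - (a\<^sup>2 + a) * v"
    and g2: "err a (Suc (Suc n)) = (w + u + v) + (w + u) - (a\<^sup>2 + a) * w"
    by (simp_all add: err_def u_def v_def w_def)
  show ?thesis unfolding g0 g1 g2 using a by algebra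
qed

lemma energy_Suc: "energy a (Suc n) = a * (a - 1) * energy a n"
  unfolding energy_def err_rec by algebra

lemma energy_ge: "(a - 1) * (3 * a + 1) / 4 * (err a n)\<^sup>2 \<le> energy a n"
proof -
  have "energy a n - (a - 1) * (3 * a + 1) / 4 * (err a n)\<^sup>2
      = (err a (Suc n) + (a - 1) / 2 * err a n)\<^sup>2"
    by (simp add: energy_def power2_eq_square field_simps)
  then show ?thesis using zero_le_power2[of "err a (Suc n) + (a - 1) / 2 * err a n"] by linarith
qed

lemma coeff_ge: "0.62 \<le> (a - 1) * (3 * a + 1) / 4"
  using a_bounds a_square_bounds by (simp add: algebra_simps power2_eq_square)

lemma energy_nonneg: "0 \<le> energy a n"
proof -
  have "0 \<le> (a - 1) * (3 * a + 1) / 4 * (err a n)\<^sup>2"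
    by (rule mult_nonneg_nonneg[OF order_trans[OF _ coeff_ge]]) simp_all
  then show ?thesis using energy_ge[of n] by linarith
qed

lemma energy_antimono: "m \<le> n \<Longrightarrow> energy a n \<le> energy a m"
proof (induction n rule: dec_induct)
  case (step n)
  have "a * (a - 1) \<le> 1" using a_bounds a_square_bounds by (simp add: algebra_simps power2_eq_square)
  then have "energy a (Suc n) \<le> energy a n"
    unfolding energy_Suc using energy_nonneg[of n] mult_right_mono[of "a * (a - 1)" 1 "energy a n"] by simp
  then show ?case using step by simp
qed simp

lemma err_square_le: "m \<le> n \<Longrightarrow> 0.62 * (err a n)\<^sup>2 \<le> energy a m"
  using energy_ge[of n] energy_antimono[of m n] mult_right_mono[OF coeff_ge, of "(err a n)\<^sup>2"]
  by simp

text \<open>Together with \<open>err_square_le\<close> this gives an absolute value of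
  \<open>err\<close> below 1 from index 3 on.\<close>

lemma energy_3: "energy a 3 < 0.62"
proof -
  define r s where "r = - err a 3" and "s = err a 4"
  have "err a 3 = 10 - 3 * (a\<^sup>2 + a)" "err a 4 = 15 - 4 * (a\<^sup>2 + a)"
    by (simp_all add: err_def eval_nat_numeral)
  then have r: "0.839 < r" "r < 0.841" and s: "0.545 < s" "s < 0.548"
    using a_bounds a_square_bounds by (simp_all add: r_def s_def)
  have "s\<^sup>2 \<le> 0.548\<^sup>2" using s by (intro power_mono) auto
  moreover have "r\<^sup>2 \<le> 0.841\<^sup>2" using r by (intro power_mono) auto
  then have "a * (a - 1) * r\<^sup>2 \<le> 0.683 * 0.841\<^sup>2"
    using a_bounds a_square_bounds by (intro mult_mono) (auto simp: algebra_simps power2_eq_square)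
  moreover have "(a - 1) * s * r \<ge> 0.465 * 0.545 * 0.839"
    using a_bounds r s by (intro mult_mono) auto
  moreover have "energy a 3 = s\<^sup>2 - (a - 1) * s * r + a * (a - 1) * r\<^sup>2"
    by (simp add: energy_def r_def s_def)
  ultimately show ?thesis by (simp add: power2_eq_square)
qed

text \<open>The exception is genuine: \<open>err a 1\<close> = 5 - (a^2 + a) exceeds 1.\<close>

lemma err_less_1:
  assumes "n \<noteq> 1"
  shows "err a n < 1"
proof -
  consider "n = 0" | "n = 2" | "n \<ge> 3" using assms by linarith
  then show ?thesis
  proof cases
    case 1
    then show ?thesis using a_bounds a_square_bounds by (simp add: err_def eval_nat_numeral)
  next
    case 2
    then show ?thesis using a_bounds a_square_bounds by (simp add: err_def eval_nat_numeral)
  next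
    case 3
    then have "(err a n)\<^sup>2 < 1\<^sup>2" using err_square_le[of 3 n] energy_3 by simp
    then show ?thesis by (rule power_less_imp_less_base) simp
  qed
qed

lemma ex_err_lower: "\<exists>K. \<forall>n. - K \<le> err a n"
proof (intro exI allI)
  fix n
  have "(err a n)\<^sup>2 \<le> energy a 0 / 0.62" using err_square_le[of 0 n] by simp
  then have "\<bar>err a n\<bar> \<le> sqrt (energy a 0 / 0.62)" by (rule real_le_rsqrt[OF power2_abs[THEN ord_eq_le_trans]])
  then show "- sqrt (energy a 0 / 0.62) \<le> err a n" by linarith
qed

section \<open>Repetitions in \<open>S\<close>\<close>

lemma nar_eq_S: "nar m = (if S (Suc m) = 2 then 3 else if S m = 2 then 1 else 2)"
proof -
  consider "nar m = 1" | "nar m = 2" | "nar m = 3" using nar_cases by auto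
  then show ?thesis
  proof cases
    case 1
    then obtain k where "m = Suc k" "nar k = 3" by (rule nar_eq_1D)
    then show ?thesis using 1 by (simp add: S_Suc)
  next
    case 2
    then obtain k where "m = Suc k" "nar k = 1" by (rule nar_eq_2D)
    then show ?thesis using 2 by (simp add: S_Suc)
  qed (simp add: S_Suc)
qed

text \<open>Three equal letters of \<open>S\<close> would force 333 in \<open>nar\<close>. A 3
  followed by a 3 is the image of a 2; after that 2 comes a 3, whose image 31 contradicts the third
  3.\<close>

lemma S_cube_free_letter: "\<not> (S i = S (Suc i) \<and> S (Suc i) = S (Suc (Suc i)))"
proof
  assume S: "S i = S (Suc i) \<and> S (Suc i) = S (Suc (Suc i))"
  then have eq: "nar i = nar (Suc i)" by (simp add: nar_eq_S)
  then have x3: "nar i = 3" using nar_cases[of i] nar_Suc_of_1[of i] nar_Suc_of_2[of i] by auto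
  then have "S i = 2" using S by (simp add: S_Suc)
  then obtain m where m: "i = Suc m" "nar m = 3" using S_0 S_Suc by (cases i) (auto split: if_splits)
  define j where "j = H m"
  have j: "m = pos j" using eq_pos_H[of m] m by (simp add: j_def)
  have "nar j \<noteq> 3" using nar_Suc_pos_3[of j] j m x3 by auto
  moreover have "nar j \<noteq> 1" using nar_pos[of j] j m by auto
  ultimately have "nar j = 2" using nar_cases by blast
  then have "pos (Suc j) = i" "nar (Suc j) = 3" using m j by (simp_all add: pos_Suc nar_Suc_of_2)
  then show False using nar_Suc_pos_3[of "Suc j"] eq x3 by simp
qed

text \<open>Decoding costs one letter, so an overlap e in \<open>S\<close> leaves e - 1 in
  \<open>nar\<close>. Of the constants 5 and 4 at least 1 remains, enough to absorb
  \<open>err\<close> < 1.\<close>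

lemma S_repetition_bound:
  assumes "p \<ge> 1" and rep: "\<And>k. k < e \<Longrightarrow> S (i + k) = S (i + p + k)"
  shows "3 * real e < (a\<^sup>2 + a + 2) * real p"
proof -
  have p: "(a\<^sup>2 + a + 2) * 1 \<le> (a\<^sup>2 + a + 2) * real p"
    using assms(1) a_bounds a_square_bounds by (intro mult_left_mono) auto
  show ?thesis
  proof (cases "e \<le> 1")
    case True
    then have "3 * real e \<le> 3" by simp
    also have "3 < (a\<^sup>2 + a + 2) * 1" using a_bounds a_square_bounds by simp
    also note p
    finally show ?thesis .
  next
    case False
    have "nar (i + k) = nar (i + p + k)" if "k < e - 1" for k
      using rep[of k] rep[of "Suc k"] that by (simp add: nar_eq_S)
    from repetition_bound[OF assms(1) this] False obtain n where n: "Nar n \<le> p"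
      "3 * (e - 1) + (if even n then 5 else 4) \<le> Nar (n + 2) + Nar (n + 1) + 2 * Nar n"
      by (metis One_nat_def diff_is_0_eq)
    show ?thesis
    proof (cases "n = 1")
      case True
      then have e: "e = 2" using n(2) False by (simp add: eval_nat_numeral)
      \<comment> \<open>For p = 1 the claim would fail, as a^2 + a + 2 < 6, but e = 2 would then be
        a cube of a letter.\<close>
      have "p \<noteq> 1"
        using rep[of 0] rep[of 1] e S_cube_free_letter[of i] by auto
      then have "(a\<^sup>2 + a + 2) * 2 \<le> (a\<^sup>2 + a + 2) * real p"
        using assms(1) a_bounds a_square_bounds by (intro mult_left_mono) auto
      then show ?thesis using e a_bounds a_square_bounds by simp
    next
      case ne: False
      have "3 * e + 1 \<le> Nar (n + 2) + Nar (n + 1) + 2 * Nar n"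
        using n(2) False by (simp split: if_splits)
      then have "real (3 * e + 1) \<le> real (Nar (n + 2) + Nar (n + 1) + 2 * Nar n)"
        by (simp only: of_nat_le_iff)
      then have "3 * real e + 1 \<le> err a n + (a\<^sup>2 + a + 2) * real (Nar n)"
        by (simp add: err_def algebra_simps)
      moreover have "(a\<^sup>2 + a + 2) * real (Nar n) \<le> (a\<^sup>2 + a + 2) * real p"
        using n(1) a_bounds a_square_bounds by (intro mult_left_mono) auto
      ultimately show ?thesis using err_less_1[OF ne] by linarith
    qed
  qed
qed

end

section \<open>The critical exponent\<close>

lemma has_period_factor_iff:
  "has_period (w [i \<rightarrow> i + p + e]) p \<longleftrightarrow> p \<ge> 1 \<and> (\<forall>k<e. w (i + k) = w (i + p + k))"
  by (auto simp: has_period_def list_eq_iff_nth_eq subsequence_def add_ac)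

lemma exponent_factor_le:
  assumes "a ^ 3 = a ^ 2 + (1::real)" "w \<in> factors S - {[]}"
  shows "exponent w \<le> (a ^ 2 + a + 5) / 3"
proof -
  define p where "p = (LEAST p. has_period w p)"
  have per: "has_period w p"
    unfolding p_def by (rule LeastI) (use assms(2) has_period_length in blast)
  obtain i j where w: "w = S [i \<rightarrow> j]" "i \<le> j" using assms(2) by (auto simp: factors_def)
  define e where "e = length w - p"
  have len: "length w = p + e" and p1: "p \<ge> 1" using per by (auto simp: has_period_def e_def)
  have "j = i + p + e" using len w by simp
  then have "\<forall>k<e. S (i + k) = S (i + p + k)" using per w by (simp add: has_period_factor_iff)
  then have "3 * real e < (a\<^sup>2 + a + 2) * real p"
    using S_repetition_bound[OF assms(1) p1] by blast
  then show ?thesis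
    using p1 by (simp add: exponent_def p_def[symmetric] len field_simps)
qed

lemma exponent_ge:
  assumes "has_period w p"
  shows "real (length w) / real p \<le> exponent w"
proof -
  define q where "q = (LEAST p. has_period w p)"
  have "q \<le> p" unfolding q_def using assms by (rule Least_le)
  moreover have "has_period w q" unfolding q_def using assms by (rule LeastI)
  ultimately show ?thesis
    unfolding exponent_def q_def[symmetric]
    by (intro divide_left_mono) (auto simp: has_period_def)
qed

lemma ex_exponent_gt:
  assumes a: "a ^ 3 = a ^ 2 + (1::real)" and y: "y < (a ^ 2 + a + 5) / 3"
  shows "\<exists>w \<in> factors S - {[]}. y < exponent w"
proof -
  obtain K where K: "\<And>n. - K \<le> err a n" using ex_err_lower[OF a] by blast
  define D where "D = (a ^ 2 + a + 5) / 3 - y"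
  have D: "D > 0" using y by (simp add: D_def)
  \<comment> \<open>The loss in 3 e is at most K + 5, where 5 covers both parities, while the gap to
    y contributes 3 D \<open>Nar n\<close>, at least 3 D n.\<close>
  obtain n where n: "(K + 5) / (3 * D) < real n"
    using reals_Archimedean2 by blast
  obtain i e where l: "level n i (Nar n) e" using ex_level_Nar by blast
  have P1: "Nar n \<ge> 1" using Nar_pos[of n] by simp
  \<comment> \<open>The shift by one is due to the initial 1 of \<open>S\<close>:
    \<open>S (Suc k)\<close> encodes \<open>nar k\<close>.\<close>
  define w where "w = S [Suc i \<rightarrow> Suc i + Nar n + e]"
  have per: "has_period w (Nar n)"
    using l P1 unfolding w_def has_period_factor_iff by (auto simp: level_def run_def S_Suc)
  have "Nar (n + 2) + Nar (n + 1) + 2 * Nar n \<le> 3 * e + 5" using l by (auto simp: level_def)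
  then have "real (Nar (n + 2) + Nar (n + 1) + 2 * Nar n) \<le> real (3 * e + 5)" by (simp only: of_nat_le_iff)
  then have "err a n + (a\<^sup>2 + a + 2) * real (Nar n) \<le> 3 * real e + 5" by (simp add: err_def algebra_simps)
  then have e: "(a\<^sup>2 + a + 2) * real (Nar n) - (K + 5) \<le> 3 * real e" using K[of n] by simp
  have "(K + 5) < 3 * D * real n" using n D by (simp add: field_simps)
  also have "\<dots> \<le> 3 * D * real (Nar n)" using D le_Nar[of n] by simp
  finally have "y * real (Nar n) < real (Nar n + e)" using e by (simp add: D_def field_simps)
  then have "y < real (Nar n + e) / real (Nar n)" using P1 by (simp add: field_simps)
  also have "real (Nar n + e) / real (Nar n) = real (length w) / real (Nar n)" by (simp add: w_def)
  also have "\<dots> \<le> exponent w" by (rule exponent_ge[OF per])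
  finally have "y < exponent w" .
  moreover have "w \<in> factors S" unfolding w_def factors_def
    using le_add1[of "Suc i" "Nar n + e"] by (metis (mono_tags, lifting) add.assoc mem_Collect_eq)
  moreover have "w \<noteq> []" using per by (auto simp: has_period_def)
  ultimately show ?thesis by blast
qed

theorem theorem39:
  fixes \<alpha> :: real
  assumes "\<alpha> ^ 3 = \<alpha> ^ 2 + 1"
  shows "critical_exponent S = ereal ((\<alpha> ^ 2 + \<alpha> + 5) / 3)"
proof (rule antisym)
  show "critical_exponent S \<le> ereal ((\<alpha> ^ 2 + \<alpha> + 5) / 3)"
    unfolding critical_exponent_def
    by (rule SUP_least) (simp only: ereal_less_eq exponent_factor_le[OF assms])
  show "ereal ((\<alpha> ^ 2 + \<alpha> + 5) / 3) \<le> critical_exponent S"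
  proof (rule ccontr)
    assume "\<not> ?thesis"
    then obtain y where y: "critical_exponent S < ereal y" "ereal y < ereal ((\<alpha> ^ 2 + \<alpha> + 5) / 3)"
      using ereal_dense2 by (meson not_le)
    then obtain w where w: "w \<in> factors S - {[]}" "y < exponent w"
      using ex_exponent_gt[OF assms] by auto
    then have "ereal (exponent w) \<le> critical_exponent S"
      unfolding critical_exponent_def by (intro SUP_upper)
    then have "ereal (exponent w) < ereal y" using y(1) by (rule le_less_trans)
    then show False using w(2) by simp
  qed
qed

end
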